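(* Let $X$ be a nonempty set, let $D$ be a nonempty subset of $X^*$, and let $F\colon X^*\to\mathrm{ran}(F)$ be such that $F(D)\subseteq X^*$. Then $F\in\mathcal{A}'_D$ if and only if $F\in\mathcal{P}'_D$ and $F$ satisfies $F|_D=F\circ F|_D$ (that is, $F(F(\mathbf{y}))=F(\mathbf{y})$ for every $\mathbf{y}\in D$).
   Context: For a nonempty set $X$, $X^*=\bigcup_{n\geqslant 0}X^n$ is the set of all finite strings (tuples) over $X$, including the empty string $\varepsilon$ ($X^0=\{\varepsilon\}$), endowed with concatenation, written by juxtaposition, with neutral element $\varepsilon$. $\mathrm{ran}(F)$ denotes the range of $F$, which is an arbitrary set (not assumed to be contained in $X^*$). For a nonempty $D\subseteq X^*$: $\mathcal{A}'_D$ is the class of functions $F\colon X^*\to\mathrm{ran}(F)$ such that $F(D)\subseteq X^*$ and $F(\mathbf{x}\mathbf{y}\mathbf{z})=F(\mathbf{x}F(\mathbf{y})\mathbf{z})$ for all $\mathbf{x},\mathbf{y},\mathbf{z}\in X^*$ with $F(\mathbf{y})\in F(D)$. $\mathcal{P}'_D$ is the class of functions $F\colon X^*\to\mathrm{ran}(F)$ such that for all $\mathbf{x},\mathbf{y},\mathbf{y}',\mathbf{z}\in X^*$ with $\mathbf{y}\in D$, $F(\mathbf{y})=F(\mathbf{y}')$ implies $F(\mathbf{x}\mathbf{y}\mathbf{z})=F(\mathbf{x}\mathbf{y}'\mathbf{z})$ (here $\mathbf{y}'$ is not required to lie in $D$). *)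

theory Defs
  imports Main
begin

text \<open>
  The set \<open>X\<^sup>*\<close> of strings over \<open>X\<close> is \<open>lists X\<close>, with concatenation \<open>@\<close> and neutral element \<open>[]\<close>.

  The codomain of \<open>F\<close> is an arbitrary set that may or may not contain strings. It is rendered as the
  disjoint union \<open>'a list + 'b\<close>: a value \<open>Inl w\<close> is the string \<open>w\<close>, a value \<open>Inr b\<close> is an object that is
  not a string over \<open>'a\<close>. Since \<open>'b\<close> is arbitrary, every codomain is covered. The values
  of \<open>F\<close> outside \<open>lists X\<close> play no role.
\<close>

abbreviation strings :: "'a set \<Rightarrow> ('a list + 'b) set" where
  "strings X \<equiv> Inl ` lists X"

text \<open>
  The term \<open>F(xF(y)z)\<close> only makes sense if \<open>F(y)\<close> is a string. In \<open>class_A'\<close> this is guaranteed by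
  \<open>F y \<in> F ` D\<close> and \<open>F ` D \<subseteq> strings X\<close>, so \<open>projl\<close> is only applied to values \<open>Inl w\<close>.
\<close>

definition class_A' :: "'a set \<Rightarrow> 'a list set \<Rightarrow> ('a list \<Rightarrow> 'a list + 'b) set" where
  "class_A' X D =
    {F. F ` D \<subseteq> strings X \<and>
        (\<forall>x \<in> lists X. \<forall>y \<in> lists X. \<forall>z \<in> lists X.
           F y \<in> F ` D \<longrightarrow> F (x @ y @ z) = F (x @ projl (F y) @ z))}"

definition class_P' :: "'a set \<Rightarrow> 'a list set \<Rightarrow> ('a list \<Rightarrow> 'a list + 'b) set" where
  "class_P' X D =
    {F. \<forall>x \<in> lists X. \<forall>y \<in> lists X. \<forall>y' \<in> lists X. \<forall>z \<in> lists X.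
           y \<in> D \<longrightarrow> F y = F y' \<longrightarrow> F (x @ y @ z) = F (x @ y' @ z)}"

end

theory Submission
  imports Defs
begin

text \<open>The class A' says that a factor \<open>y\<close> whose value is attained on
  \<open>D\<close> may be replaced by the string \<open>F y\<close> in any context. If
  \<open>F y = F y'\<close> with \<open>y\<close> in \<open>D\<close>, both factors are replaced by
  the same string, which gives P'; the empty context gives \<open>F (projl (F y)) = F y\<close>.
  Conversely, let \<open>F y = F d\<close> with \<open>d\<close> in \<open>D\<close>, and let
  \<open>w\<close> be the string \<open>F d\<close>. Then \<open>y\<close>, \<open>d\<close> and
  \<open>w\<close> share one value, so P' exchanges \<open>y\<close> for \<open>w\<close> by way of
  \<open>d\<close>.\<close>

theorem proposition3p3:
  fixes X :: "'a set" and D :: "'a list set" and F :: "'a list \<Rightarrow> 'a list + 'b"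
  assumes "X \<noteq> {}"
    and "D \<noteq> {}"
    and "D \<subseteq> lists X"
    and "F ` D \<subseteq> strings X"
  shows "F \<in> class_A' X D \<longleftrightarrow>
    F \<in> class_P' X D \<and> (\<forall>y \<in> D. F (projl (F y)) = F y)"
proof (intro iffI conjI ballI)
  assume A': "F \<in> class_A' X D"
  have A: "F (x @ y @ z) = F (x @ projl (F y) @ z)"
    if "x \<in> lists X" "y \<in> lists X" "z \<in> lists X" "F y \<in> F ` D" for x y z
    using A' that unfolding class_A'_def by blast
  show "F \<in> class_P' X D"
    unfolding class_P'_def
  proof (intro CollectI ballI impI)
    fix x y y' z
    assume lists: "x \<in> lists X" "y \<in> lists X" "y' \<in> lists X" "z \<in> lists X"
      and "y \<in> D" and eq: "F y = F y'"
    \<comment> \<open>The premise of A' constrains the value and not the argument, so it passes from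
      \<open>y\<close> to \<open>y'\<close> even if \<open>y'\<close> lies outside
      \<open>D\<close>.\<close>
    then have "F y \<in> F ` D" "F y' \<in> F ` D"
      by (metis imageI)+
    then show "F (x @ y @ z) = F (x @ y' @ z)"
      using A lists eq by metis
  qed
  show "F (projl (F y)) = F y" if "y \<in> D" for y
  proof -
    have "y \<in> lists X"
      using that assms(3) by blast
    then show ?thesis
      using A[of "[]" y "[]"] that by simp
  qed
next
  assume R: "F \<in> class_P' X D \<and> (\<forall>y \<in> D. F (projl (F y)) = F y)"
  have P: "F (x @ y @ z) = F (x @ y' @ z)"
    if "x \<in> lists X" "y \<in> D" "y' \<in> lists X" "z \<in> lists X" "F y = F y'" for x y y' z
  proof -
    have "y \<in> lists X"
      using that(2) assms(3) by blast
    with R that show ?thesis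
      unfolding class_P'_def by blast
  qed
  show "F \<in> class_A' X D"
    unfolding class_A'_def
  proof (intro CollectI conjI ballI impI)
    show "F ` D \<subseteq> strings X"
      by (fact assms(4))
    fix x y z
    assume lists: "x \<in> lists X" "y \<in> lists X" "z \<in> lists X" and "F y \<in> F ` D"
    then obtain d where d: "d \<in> D" "F d = F y"
      by force
    then obtain w where w: "w \<in> lists X" "F d = Inl w"
      using assms(4) by blast
    \<comment> \<open>The fixed-value condition is applied at \<open>d\<close>, since it says
      nothing about a \<open>y\<close> outside \<open>D\<close>.\<close>
    have "F d = F w"
      using R d(1) w(2) by force
    \<comment> \<open>Both \<open>y\<close> and \<open>F y\<close> have the same value as \<open>d \<in> D\<close>; neither need lie in \<open>D\<close> itself.\<close>
    then have "F (x @ y @ z) = F (x @ w @ z)"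
      using P[of x d y z] P[of x d w z] lists d w(1) by simp
    then show "F (x @ y @ z) = F (x @ projl (F y) @ z)"
      using d(2) w(2) by (metis sum.sel(1))
  qed
qed

end
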